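(* Let $T$ be a set of transpositions in the symmetric group $S_m$ such that $G_T\cong C_m$, the cycle graph with $m$ vertices. Then $\mathrm{Cay}(S_m,T)$ is integral if and only if $m=3$ or $m=4$.
   Context: $S_m$ is the symmetric group on $\{1,\dots,m\}$. For a group $G$ and an inverse-closed subset $S\subseteq G$ not containing the identity, $\mathrm{Cay}(G,S)$ is the graph with vertex set $G$ in which $g_1,g_2$ are adjacent if and only if $g_1g_2^{-1}\in S$. For a set $T$ of transpositions in $S_m$, $G_T$ is the graph with vertex set $\{1,\dots,m\}$ in which $i,j$ are adjacent if and only if $(i,j)\in T$. A finite simple graph is integral if all eigenvalues of its adjacency matrix are integers. Graphs are simple, so the cycle $C_m$ has $m\ge 3$. *)

theory Defs
  imports
    "HOL-Algebra.Sym_Groups"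
    "HOL-Combinatorics.Transposition"
    "Graph_Theory.Pair_Digraph"
    "Graph_Theory.Digraph_Isomorphism"
    "Jordan_Normal_Form.Char_Poly"
begin

text \<open>
  Finite simple graphs are represented by the locale \<^locale>\<open>pair_graph\<close>: finite, symmetric,
  loop-free digraphs without parallel arcs.  An edge is thus a pair of opposite arcs.
\<close>

definition cayley_graph :: "('a, 'b) monoid_scheme \<Rightarrow> 'a set \<Rightarrow> 'a pair_pre_digraph" where
  "cayley_graph G S =
    \<lparr> pverts = carrier G,
      parcs = {(g, h). g \<in> carrier G \<and> h \<in> carrier G \<and> g \<otimes>\<^bsub>G\<^esub> inv\<^bsub>G\<^esub> h \<in> S} \<rparr>"

definition transpositions :: "nat \<Rightarrow> (nat \<Rightarrow> nat) set" where
  "transpositions m =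
    {Transposition.transpose i j | i j. i \<in> {1..m} \<and> j \<in> {1..m} \<and> i \<noteq> j}"

definition transposition_graph :: "nat \<Rightarrow> (nat \<Rightarrow> nat) set \<Rightarrow> nat pair_pre_digraph" where
  "transposition_graph m T =
    \<lparr> pverts = {1..m},
      parcs = {(i, j). i \<in> {1..m} \<and> j \<in> {1..m} \<and> i \<noteq> j \<and> Transposition.transpose i j \<in> T} \<rparr>"

text \<open>The following is a cycle (and a simple graph) only for \<^prop>\<open>m \<ge> 3\<close>.\<close>

definition cycle_graph :: "nat \<Rightarrow> nat pair_pre_digraph" where
  "cycle_graph m =
    \<lparr> pverts = {0..<m},
      parcs = {(i, j). i < m \<and> j < m \<and> (j = Suc i mod m \<or> i = Suc j mod m)} \<rparr>"

text \<open>
  Matrices are indexed by \<open>{0..<n}\<close>, so the adjacency matrix is taken with respect to an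
  enumeration \<open>vs\<close> of the vertices.
\<close>

definition adjacency_matrix :: "'a pair_pre_digraph \<Rightarrow> 'a list \<Rightarrow> complex mat" where
  "adjacency_matrix G vs =
    mat (length vs) (length vs) (\<lambda>(i, j). if (vs ! i, vs ! j) \<in> parcs G then 1 else 0)"

text \<open>
  The eigenvalues do not depend on the enumeration; one exists since \<^locale>\<open>pair_graph\<close>
  entails finiteness.
\<close>

definition integral_graph :: "'a pair_pre_digraph \<Rightarrow> bool" where
  "integral_graph G \<longleftrightarrow> pair_graph G \<and>
    (\<forall>vs k. distinct vs \<and> set vs = pverts G \<and> eigenvalue (adjacency_matrix G vs) k \<longrightarrow> k \<in> \<int>)"

lemma pair_graph_cayley_graph:
  assumes "group G" "finite (carrier G)" "S \<subseteq> carrier G"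
    and "\<And>s. s \<in> S \<Longrightarrow> inv\<^bsub>G\<^esub> s \<in> S" and "\<one>\<^bsub>G\<^esub> \<notin> S"
  shows "pair_graph (cayley_graph G S)"
proof -
  interpret group G by fact
  have *: "h \<otimes>\<^bsub>G\<^esub> inv\<^bsub>G\<^esub> g \<in> S"
    if "g \<in> carrier G" "h \<in> carrier G" "g \<otimes>\<^bsub>G\<^esub> inv\<^bsub>G\<^esub> h \<in> S" for g h
    using assms(4)[OF that(3)] that(1,2) by (simp add: inv_mult_group)
  have fin: "finite (parcs (cayley_graph G S))"
    by (rule finite_subset[of _ "carrier G \<times> carrier G"])
       (auto simp: cayley_graph_def assms(2))
  show ?thesis
    by unfold_locales
       (use assms(2,5) fin * in \<open>auto simp: cayley_graph_def symmetric_def intro!: symI\<close>)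
qed

lemma pair_graph_cycle_graph:
  assumes "m \<ge> 3"
  shows "pair_graph (cycle_graph m)"
proof -
  have fin: "finite (parcs (cycle_graph m))"
    by (rule finite_subset[of _ "{0..<m} \<times> {0..<m}"]) (auto simp: cycle_graph_def)
  have ne: "Suc i mod m \<noteq> i" if "i < m" for i
    using that assms by (cases "Suc i = m") auto
  show ?thesis
    by unfold_locales
       (use ne fin in \<open>auto simp: cycle_graph_def symmetric_def intro!: symI dest: sym\<close>)
qed

end

theory Submission
  imports Defs
begin

text \<open>
  After relabelling, \<open>T\<close> consists of the transpositions \<open>s\<^sub>k = (k, k + 1 mod m)\<close>, and \<open>l\<close> is an
  eigenvalue iff some nonzero function \<open>f\<close> on the permutations satisfies
  \<open>(\<Sum>k<m. f (s\<^sub>k \<circ> p)) = l * f p\<close> for all \<open>p\<close>.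

  Functions of \<open>p 0\<close> alone see only the cycle graph and give the eigenvalue
  \<open>m - 2 + 2 cos (2 \<pi> / m)\<close>, which is not an integer for \<open>m = 5\<close> and \<open>m \<ge> 7\<close>. For \<open>m = 6\<close>, the
  functions of the distance between \<open>p 0\<close> and \<open>p 1\<close> on the cycle form a three-dimensional invariant
  space, on which the eigenvalues are \<open>6\<close> and \<open>1 \<plusminus> sqrt 5\<close>. For \<open>m = 3\<close> and \<open>m = 4\<close>, computing the
  square of the adjacency operator shows that \<open>l\<^sup>2\<close> lies in \<open>{0, 9}\<close> and \<open>{0, 4, 16}\<close>, respectively.
\<close>

section \<open>Eigenvectors as functions on the vertices\<close>

text \<open>Indexing by \<open>vs\<close> is a bijection onto the vertices, so vectors correspond to
  functions on them. The right-hand side is free of \<open>vs\<close>, hence independent of the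
  enumeration.\<close>

lemma eigenvalue_adjacency_matrix_iff:
  assumes "distinct vs" and vs: "set vs = pverts G"
  shows "eigenvalue (adjacency_matrix G vs) k \<longleftrightarrow>
    (\<exists>f. (\<exists>v\<in>pverts G. f v \<noteq> 0) \<and>
      (\<forall>v\<in>pverts G. (\<Sum>u | u \<in> pverts G \<and> (v, u) \<in> parcs G. f u) = k * f v))"
proof -
  let ?A = "adjacency_matrix G vs" and ?n = "length vs"
  have bij: "bij_betw (\<lambda>i. vs ! i) {0..<?n} (pverts G)"
    using bij_betw_nth[OF \<open>distinct vs\<close>] vs by (metis atLeast0LessThan)
  have entry: "(?A *\<^sub>v v) $ i = (\<Sum>u | u \<in> pverts G \<and> (vs ! i, u) \<in> parcs G. f u)"
    if "i < ?n" "v \<in> carrier_vec ?n" "\<And>j. j < ?n \<Longrightarrow> v $ j = f (vs ! j)" for i v f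
  proof -
    have "(?A *\<^sub>v v) $ i = (\<Sum>j = 0..<?n. if (vs ! i, vs ! j) \<in> parcs G then f (vs ! j) else 0)"
      using that by (auto simp: adjacency_matrix_def scalar_prod_def intro!: sum.cong)
    also have "\<dots> = (\<Sum>u\<in>pverts G. if (vs ! i, u) \<in> parcs G then f u else 0)"
      by (rule sum.reindex_bij_betw[OF bij])
    also have "\<dots> = (\<Sum>u | u \<in> pverts G \<and> (vs ! i, u) \<in> parcs G. f u)"
      using vs by (subst sum.inter_filter[symmetric]) (auto simp flip: vs)
    finally show ?thesis .
  qed
  have dim: "dim_row ?A = ?n"
    by (simp add: adjacency_matrix_def)
  show ?thesis
  proof
    assume "eigenvalue ?A k"
    then obtain v where v: "v \<in> carrier_vec ?n" "v \<noteq> 0\<^sub>v ?n" "?A *\<^sub>v v = k \<cdot>\<^sub>v v"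
      by (auto simp: eigenvalue_def eigenvector_def dim)
    define f where "f x = v $ (the_inv_into {0..<?n} (\<lambda>i. vs ! i) x)" for x
    have f: "f (vs ! j) = v $ j" if "j < ?n" for j
      using bij that unfolding f_def by (subst the_inv_into_f_f) (auto simp: bij_betw_def)
    show "\<exists>f. (\<exists>v\<in>pverts G. f v \<noteq> 0) \<and>
      (\<forall>v\<in>pverts G. (\<Sum>u | u \<in> pverts G \<and> (v, u) \<in> parcs G. f u) = k * f v)"
    proof (intro exI[of _ f] conjI ballI)
      obtain i where "i < ?n" "v $ i \<noteq> 0"
        using v(1,2) by (metis carrier_vecD eq_vecI index_zero_vec)
      then show "\<exists>v\<in>pverts G. f v \<noteq> 0"
        using vs f by (metis nth_mem)
    next
      fix x assume "x \<in> pverts G"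
      then obtain i where i: "i < ?n" "x = vs ! i"
        using vs by (metis in_set_conv_nth)
      show "(\<Sum>u | u \<in> pverts G \<and> (x, u) \<in> parcs G. f u) = k * f x"
        using entry[OF i(1) v(1), of f] f v(1) i unfolding v(3) by simp
    qed
  next
    assume "\<exists>f. (\<exists>v\<in>pverts G. f v \<noteq> 0) \<and>
      (\<forall>v\<in>pverts G. (\<Sum>u | u \<in> pverts G \<and> (v, u) \<in> parcs G. f u) = k * f v)"
    then obtain f x where x: "x \<in> pverts G" "f x \<noteq> 0"
      and f: "\<And>v. v \<in> pverts G \<Longrightarrow> (\<Sum>u | u \<in> pverts G \<and> (v, u) \<in> parcs G. f u) = k * f v"
      by blast
    define v where "v = vec ?n (\<lambda>i. f (vs ! i))"
    obtain i where i: "i < ?n" "x = vs ! i"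
      using vs x(1) by (metis in_set_conv_nth)
    have "v \<noteq> 0\<^sub>v ?n"
      using i x(2) by (metis index_vec index_zero_vec(1) v_def)
    moreover have "?A *\<^sub>v v = k \<cdot>\<^sub>v v"
    proof
      fix j assume "j < dim_vec (k \<cdot>\<^sub>v v)"
      then have j: "j < ?n"
        by (simp add: v_def)
      then show "(?A *\<^sub>v v) $ j = (k \<cdot>\<^sub>v v) $ j"
        using entry[OF j, of v f] f[of "vs ! j"] nth_mem[OF j] vs by (simp add: v_def)
    qed (simp add: v_def dim)
    ultimately show "eigenvalue ?A k"
      unfolding eigenvalue_def eigenvector_def dim
      by (intro exI[of _ v]) (simp add: v_def)
  qed
qed

section \<open>Transpositions along the cycle\<close>

definition cycle_swap :: "nat \<Rightarrow> nat \<Rightarrow> nat \<Rightarrow> nat" where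
  "cycle_swap m k = Transposition.transpose k (Suc k mod m)"

text \<open>Only the values of \<open>f\<close> at permutations of \<open>{..<m}\<close> count, so
  nonvanishing is required at one of these. Swaps are composed on the left and so act on the values
  of \<open>p\<close>; this keeps functions of \<open>p 0\<close>, or of \<open>p 0\<close> and
  \<open>p 1\<close>, invariant as a class.\<close>

definition cycle_eigenfunction :: "nat \<Rightarrow> complex \<Rightarrow> ((nat \<Rightarrow> nat) \<Rightarrow> complex) \<Rightarrow> bool" where
  "cycle_eigenfunction m l f \<longleftrightarrow>
    (\<exists>p. p permutes {..<m} \<and> f p \<noteq> 0) \<and>
    (\<forall>p. p permutes {..<m} \<longrightarrow> (\<Sum>k<m. f (cycle_swap m k \<circ> p)) = l * f p)"

lemma cycle_swap_permutes: "k < m \<Longrightarrow> cycle_swap m k permutes {..<m}"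
  unfolding cycle_swap_def by (rule permutes_swap_id) auto

lemma Suc_mod_neq:
  assumes "2 \<le> m" "k < m"
  shows "Suc k mod m \<noteq> (k :: nat)"
  using assms by (cases "Suc k = m") auto

lemma inj_on_Suc_mod: "inj_on (\<lambda>k. Suc k mod m) {..<m}"
proof (rule inj_onI)
  fix i j assume "i \<in> {..<m}" "j \<in> {..<m}" "Suc i mod m = Suc j mod m"
  then show "i = j"
    by (cases "Suc i = m"; cases "Suc j = m") auto
qed

text \<open>If two different indices gave the same swap, each would be the cyclic successor of the
  other, which forces \<open>m\<close> to be at most 2.\<close>

lemma inj_on_cycle_swap:
  assumes "3 \<le> m"
  shows "inj_on (cycle_swap m) {..<m}"
proof (rule inj_onI)
  fix i j assume ij: "i \<in> {..<m}" "j \<in> {..<m}" and eq: "cycle_swap m i = cycle_swap m j"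
  show "i = j"
  proof (rule ccontr)
    assume "i \<noteq> j"
    have "cycle_swap m j i = Suc i mod m"
      unfolding eq[symmetric] by (simp add: cycle_swap_def)
    moreover have "Suc i mod m \<noteq> i"
      using assms ij by (intro Suc_mod_neq) auto
    ultimately have eqs: "i = Suc j mod m" "j = Suc i mod m"
      using \<open>i \<noteq> j\<close> by (auto simp: cycle_swap_def transpose_eq_iff)
    have "Suc k mod m = 0 \<and> Suc k = m \<or> Suc k mod m = Suc k" if "k \<in> {..<m}" for k
      using that by (cases "Suc k = m") auto
    from this[OF ij(1)] this[OF ij(2)] assms show False
      unfolding eqs[symmetric] by linarith
  qed
qed

section \<open>Relabelling the vertices by conjugation\<close>

lemma permutes_conjugate:
  assumes "bij c" "p permutes A"
  shows "c \<circ> p \<circ> inv' c permutes c ` A"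
proof (rule bij_imp_permutes)
  have "bij_betw c A (c ` A)"
    using assms(1) by (metis bij_betw_def inj_on_subset subset_UNIV)
  moreover have "bij_betw (inv' c) (c ` A) A"
    using assms(1) by (intro bij_betw_byWitness[where f' = c]) (auto simp: bij_is_inj)
  ultimately show "bij_betw (c \<circ> p \<circ> inv' c) (c ` A) (c ` A)"
    using permutes_imp_bij[OF assms(2)] by (meson bij_betw_trans)
next
  fix x assume "x \<notin> c ` A"
  then have "inv' c x \<notin> A"
    using assms(1) by (metis bij_inv_eq_iff imageI)
  then show "(c \<circ> p \<circ> inv' c) x = x"
    using assms by (simp add: permutes_not_in bij_is_surj surj_f_inv_f)
qed

lemma permutes_conjugate_iff:
  assumes "bij c"
  shows "c \<circ> p \<circ> inv' c permutes c ` A \<longleftrightarrow> p permutes A"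
proof
  assume "c \<circ> p \<circ> inv' c permutes c ` A"
  from permutes_conjugate[OF bij_imp_bij_inv[OF assms] this]
  show "p permutes A"
    using assms by (simp add: inv_inv_eq image_inv_f_f bij_is_inj comp_assoc)
      (simp add: comp_assoc[symmetric] bij_is_inj)
qed (rule permutes_conjugate[OF assms])

text \<open>Conjugating the transposition of two points by \<open>c\<close> yields the transposition
  of their images. With \<open>c\<close> inverting the vertex map of the isomorphism, edges of the
  cycle thus become exactly the transpositions in \<open>T\<close>.\<close>

lemma cycle_labelling:
  assumes "3 \<le> m" and T: "T \<subseteq> transpositions m"
    and iso: "digraph_iso (with_proj (transposition_graph m T)) (with_proj (cycle_graph m))"
  obtains c where "bij c" "c ` {..<m} = {1..m}"
    "T = (\<lambda>k. c \<circ> cycle_swap m k \<circ> inv' c) ` {..<m}"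
proof -
  let ?G = "transposition_graph m T"
  obtain h where h: "pre_digraph.digraph_isomorphism (with_proj ?G) h"
    and eq: "with_proj (cycle_graph m) = app_iso h (with_proj ?G)"
    using iso unfolding digraph_iso_def by blast
  define q where "q = iso_verts h"
  have inj: "inj_on q {1..m}"
    using pre_digraph.digraph_isomorphism_inj_on_verts[OF h]
    by (simp add: q_def transposition_graph_def)
  have img: "q ` {1..m} = {..<m}"
    using arg_cong[OF eq, of verts]
    by (simp add: q_def transposition_graph_def cycle_graph_def atLeast0LessThan)
  \<comment> \<open>A digraph isomorphism has separate maps on vertices and arcs. Arcs being ordered
    pairs here, compatibility with tail and head determines the arc map from
    \<open>q\<close>.\<close>
  have ends: "q (fst e) = fst (iso_arcs h e)" "q (snd e) = snd (iso_arcs h e)"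
    if "e \<in> parcs ?G" for e
    using pre_digraph.iso_verts_tail[OF h, of e] pre_digraph.iso_verts_head[OF h, of e] that
      arg_cong[OF eq, of tail] arg_cong[OF eq, of head]
    by (simp_all add: q_def)
  have "iso_arcs h e = (q (fst e), q (snd e))" if "e \<in> parcs ?G" for e
    using ends[OF that] by (simp add: prod_eq_iff)
  then have arcs: "parcs (cycle_graph m) = (\<lambda>e. (q (fst e), q (snd e))) ` parcs ?G"
    using arg_cong[OF eq, of arcs] by (simp cong: image_cong_simp)
  define d where "d = the_inv_into {1..m} q"
  have bd: "bij_betw d {..<m} {1..m}"
    using bij_betw_the_inv_into[of q "{1..m}" "{..<m}"] inj img by (simp add: d_def bij_betw_def)
  have qd: "q (d i) = i" if "i < m" for i
    using that img inj by (metis d_def f_the_inv_into_f lessThan_iff)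
  have dq: "d (q i) = i" if "i \<in> {1..m}" for i
    using that inj by (simp add: d_def the_inv_into_f_f)
  \<comment> \<open>Extending \<open>d\<close> to a bijection of all naturals makes relabelling a plain conjugation.\<close>
  define c where "c i = (if i < m then d i else if i = m then 0 else i)" for i
  have cd: "c i = d i" if "i < m" for i
    using that by (simp add: c_def)
  have c_img: "c ` {..<m} = {1..m}"
    using bd by (auto simp: bij_betw_def cd)
  \<comment> \<open>Three bijections are glued: \<open>d\<close> on \<open>{..<m}\<close>, the point
    \<open>m\<close> sent to the missing value \<open>0\<close>, and the identity above
    \<open>m\<close>.\<close>
  have "bij_betw c {..<m} {1..m}"
    using bd by (subst bij_betw_cong[of _ _ d]) (auto simp: cd)
  then have "bij_betw c ({..<m} \<union> {m}) ({1..m} \<union> {0})"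
    by (rule bij_betw_combine) (auto simp: bij_betw_def c_def)
  then have "bij_betw c (({..<m} \<union> {m}) \<union> {m<..}) (({1..m} \<union> {0}) \<union> {m<..})"
    by (rule bij_betw_combine) (auto simp: bij_betw_def c_def inj_on_def image_def)
  moreover have "({..<m} \<union> {m}) \<union> {m<..} = UNIV" "({1..m} \<union> {0}) \<union> {m<..} = (UNIV :: nat set)"
    by auto
  ultimately have bij: "bij c"
    by simp
  have conj: "c \<circ> cycle_swap m k \<circ> inv' c = Transposition.transpose (c k) (c (Suc k mod m))" for k
  proof -
    have "c \<circ> cycle_swap m k = Transposition.transpose (c k) (c (Suc k mod m)) \<circ> c"
      using transpose_comp_eq[OF bij, of "c k" "c (Suc k mod m)"] bij
      by (simp add: cycle_swap_def bij_is_inj)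
    then show ?thesis
      using bij by (simp add: comp_assoc surj_iff[THEN iffD1, OF bij_is_surj])
  qed
  have "T = (\<lambda>k. Transposition.transpose (c k) (c (Suc k mod m))) ` {..<m}"
  proof (intro equalityI subsetI)
    fix t assume "t \<in> T"
    then obtain i j where t: "t = Transposition.transpose i j" "i \<in> {1..m}" "j \<in> {1..m}" "i \<noteq> j"
      using T by (auto simp: transpositions_def)
    then have "(i, j) \<in> parcs ?G"
      using \<open>t \<in> T\<close> by (simp add: transposition_graph_def)
    then have "(q i, q j) \<in> parcs (cycle_graph m)"
      unfolding arcs by force
    then have lt: "q i < m" "q j < m" and adj: "q j = Suc (q i) mod m \<or> q i = Suc (q j) mod m"
      by (simp_all add: cycle_graph_def)
    have "c (q i) = i" "c (q j) = j"
      using lt t dq cd by simp_all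
    \<comment> \<open>The arc may run along the cycle or against it; in the second case the index of
      the swap is \<open>q j\<close>.\<close>
    with adj have "t = Transposition.transpose (c (q i)) (c (Suc (q i) mod m)) \<or>
        t = Transposition.transpose (c (q j)) (c (Suc (q j) mod m))"
      unfolding t(1) by (metis transpose_commute)
    with lt show "t \<in> (\<lambda>k. Transposition.transpose (c k) (c (Suc k mod m))) ` {..<m}"
      by blast
  next
    fix t assume "t \<in> (\<lambda>k. Transposition.transpose (c k) (c (Suc k mod m))) ` {..<m}"
    then obtain k where k: "k < m" "t = Transposition.transpose (c k) (c (Suc k mod m))"
      by auto
    have "(k, Suc k mod m) \<in> parcs (cycle_graph m)"
      using k by (simp add: cycle_graph_def)
    then obtain i j where ij: "(i, j) \<in> parcs ?G" "k = q i" "Suc k mod m = q j"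
      unfolding arcs by auto
    then have "i \<in> {1..m}" "j \<in> {1..m}" "Transposition.transpose i j \<in> T"
      by (simp_all add: transposition_graph_def)
    moreover have "q i < m" "q j < m"
      using k(1) by (simp_all flip: ij(2,3))
    ultimately have "c (q i) = i" "c (q j) = j"
      using dq cd by simp_all
    then show "t \<in> T"
      using \<open>Transposition.transpose i j \<in> T\<close> unfolding k(2) ij(3) unfolding ij(2) by simp
  qed
  then show ?thesis
    using that[OF bij c_img] by (simp add: conj)
qed

section \<open>The spectrum of the Cayley graph in terms of cycle swaps\<close>

lemma pair_graph_cayley_transpositions:
  assumes "T \<subseteq> transpositions m"
  shows "pair_graph (cayley_graph (sym_group m) T)"
proof (rule pair_graph_cayley_graph)
  have perm: "t permutes {1..m}" if "t \<in> T" for t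
    using assms that by (auto simp: transpositions_def intro!: permutes_swap_id)
  then show "T \<subseteq> carrier (sym_group m)"
    by (auto simp: sym_group_carrier)
  show "inv\<^bsub>sym_group m\<^esub> t \<in> T" if "t \<in> T" for t
  proof -
    have "t \<circ> t = id"
      using assms that by (auto simp: transpositions_def)
    then have "inv\<^bsub>sym_group m\<^esub> t = t"
      using perm[OF that]
      by (intro group.inv_equality[OF sym_group_is_group])
        (auto simp: sym_group_carrier sym_group_mult sym_group_one)
    then show ?thesis
      using that by simp
  qed
  show "\<one>\<^bsub>sym_group m\<^esub> \<notin> T"
  proof
    assume "\<one>\<^bsub>sym_group m\<^esub> \<in> T"
    then have "id \<in> transpositions m"
      using assms by (auto simp: sym_group_one)
    then obtain i j :: nat where "id = Transposition.transpose i j" "i \<noteq> j"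
      unfolding transpositions_def by blast
    then show False
      by (metis transpose_eq_id_iff)
  qed
  show "finite (carrier (sym_group m))"
    by (simp add: sym_group_def finite_permutations)
qed (rule sym_group_is_group)

text \<open>Conjugation \<open>?C\<close> by \<open>c\<close> is a multiplicative bijection from the
  permutations of \<open>{..<m}\<close> to the vertices. Elements of \<open>T\<close> are
  involutions, so the neighbours of \<open>x\<close> are the products \<open>t \<circ> x\<close>
  with \<open>t\<close> in \<open>T\<close>.\<close>

lemma eigenvalue_cayley_graph_iff:
  assumes "3 \<le> m" and "bij c" and c: "c ` {..<m} = {1..m}"
    and T: "T = (\<lambda>k. c \<circ> cycle_swap m k \<circ> inv' c) ` {..<m}"
    and vs: "distinct vs" "set vs = pverts (cayley_graph (sym_group m) T)"
  shows "eigenvalue (adjacency_matrix (cayley_graph (sym_group m) T) vs) l \<longleftrightarrow>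
    (\<exists>f. cycle_eigenfunction m l f)"
proof -
  let ?G = "cayley_graph (sym_group m) T"
  let ?C = "\<lambda>p. c \<circ> p \<circ> inv' c" and ?D = "\<lambda>p. inv' c \<circ> p \<circ> c"
  have verts: "x \<in> pverts ?G \<longleftrightarrow> x permutes {1..m}" for x
    by (simp add: cayley_graph_def sym_group_carrier)
  have CD: "?C (?D p) = p" "?D (?C p) = p" for p
    using \<open>bij c\<close> by (simp_all add: fun_eq_iff bij_is_inj bij_is_surj surj_f_inv_f)
  have C_comp: "?C (p \<circ> q) = ?C p \<circ> ?C q" for p q
    using \<open>bij c\<close> by (simp add: fun_eq_iff bij_is_inj)
  have C_perm: "?C p permutes {1..m} \<longleftrightarrow> p permutes {..<m}" for p
    using permutes_conjugate_iff[OF \<open>bij c\<close>, of p "{..<m}"] c by simp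
  have inj_C: "inj ?C"
    by (rule inj_on_inverseI[of _ ?D]) (rule CD(2))
  have arc: "(x, y) \<in> parcs ?G \<longleftrightarrow> (\<exists>k<m. y = ?C (cycle_swap m k) \<circ> x)"
    if x: "x permutes {1..m}" and y: "y permutes {1..m}" for x y
  proof -
    have inv: "inv\<^bsub>sym_group m\<^esub> y = inv' y"
      using y by (intro group.inv_equality[OF sym_group_is_group])
        (auto simp: sym_group_carrier sym_group_mult sym_group_one permutes_inv permutes_inv_o)
    have "x \<circ> inv' y = t \<longleftrightarrow> y = t \<circ> x" if t: "t \<circ> t = id" for t
    proof
      assume "x \<circ> inv' y = t"
      then have "t \<circ> x = t \<circ> t \<circ> y"
        using permutes_inv_o(2)[OF y] by (metis comp_assoc comp_id)
      then show "y = t \<circ> x"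
        using t by simp
    next
      assume "y = t \<circ> x"
      then have "x = t \<circ> y"
        using t by (simp add: comp_assoc[symmetric])
      then show "x \<circ> inv' y = t"
        using permutes_inv_o(1)[OF y] by (simp add: comp_assoc)
    qed
    moreover have "?C (cycle_swap m k) \<circ> ?C (cycle_swap m k) = id" for k
      unfolding C_comp[symmetric] using \<open>bij c\<close>
      by (simp add: cycle_swap_def fun_eq_iff bij_is_surj surj_f_inv_f)
    ultimately have "x \<circ> inv' y = ?C (cycle_swap m k) \<longleftrightarrow> y = ?C (cycle_swap m k) \<circ> x" for k
      by blast
    then show ?thesis
      using x y by (auto simp: cayley_graph_def sym_group_carrier sym_group_mult inv T)
  qed
  have sum_nbrs: "(\<Sum>u | u \<in> pverts ?G \<and> (?C p, u) \<in> parcs ?G. f u) =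
      (\<Sum>k<m. f (?C (cycle_swap m k \<circ> p)))" if p: "p permutes {..<m}" for f :: "_ \<Rightarrow> complex" and p
  proof -
    have "{u. u \<in> pverts ?G \<and> (?C p, u) \<in> parcs ?G} = (\<lambda>k. ?C (cycle_swap m k \<circ> p)) ` {..<m}"
      (is "?L = ?R")
    proof (intro equalityI subsetI)
      fix u assume "u \<in> ?L"
      then show "u \<in> ?R"
        using arc[of "?C p" u] p unfolding verts C_perm C_comp by blast
    next
      fix u assume "u \<in> ?R"
      then obtain k where k: "k < m" "u = ?C (cycle_swap m k \<circ> p)"
        by blast
      then have "u permutes {1..m}"
        unfolding k(2) C_perm using p by (intro permutes_compose cycle_swap_permutes)
      moreover from this have "(?C p, u) \<in> parcs ?G"
        using arc[of "?C p" u] p k unfolding C_perm C_comp by blast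
      ultimately show "u \<in> ?L"
        unfolding verts by blast
    qed
    \<comment> \<open>Different \<open>k\<close> give different neighbours, so the sum over
      \<open>k<m\<close> counts each neighbour once.\<close>
    moreover have "inj_on (\<lambda>k. ?C (cycle_swap m k \<circ> p)) {..<m}"
    proof (rule inj_onI)
      fix i j assume ij: "i \<in> {..<m}" "j \<in> {..<m}"
        and "?C (cycle_swap m i \<circ> p) = ?C (cycle_swap m j \<circ> p)"
      then have "cycle_swap m i \<circ> p = cycle_swap m j \<circ> p"
        using inj_C by (meson injD)
      then have "cycle_swap m i = cycle_swap m j"
        using permutes_surj[OF p] by (metis fun.inj_map_strong surj_fun_eq)
      then show "i = j"
        using inj_on_cycle_swap[OF \<open>3 \<le> m\<close>] ij by (meson inj_onD)
    qed
    ultimately show ?thesis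
      by (simp add: sum.reindex)
  qed
  have "eigenvalue (adjacency_matrix ?G vs) l \<longleftrightarrow>
    (\<exists>f. (\<exists>v\<in>pverts ?G. f v \<noteq> 0) \<and>
      (\<forall>v\<in>pverts ?G. (\<Sum>u | u \<in> pverts ?G \<and> (v, u) \<in> parcs ?G. f u) = l * f v))"
    by (rule eigenvalue_adjacency_matrix_iff[OF vs])
  also have "\<dots> \<longleftrightarrow> (\<exists>f. cycle_eigenfunction m l f)"
  proof
    assume "\<exists>f. (\<exists>v\<in>pverts ?G. f v \<noteq> 0) \<and>
      (\<forall>v\<in>pverts ?G. (\<Sum>u | u \<in> pverts ?G \<and> (v, u) \<in> parcs ?G. f u) = l * f v)"
    then obtain f x where "x \<in> pverts ?G" and f: "f x \<noteq> 0"
      "\<And>v. v \<in> pverts ?G \<Longrightarrow> (\<Sum>u | u \<in> pverts ?G \<and> (v, u) \<in> parcs ?G. f u) = l * f v"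
      by blast
    have "cycle_eigenfunction m l (\<lambda>p. f (?C p))"
      unfolding cycle_eigenfunction_def
    proof (intro conjI allI impI)
      show "\<exists>p. p permutes {..<m} \<and> f (?C p) \<noteq> 0"
      proof (intro exI conjI)
        show "?D x permutes {..<m}"
          using \<open>x \<in> pverts ?G\<close> unfolding C_perm[symmetric] CD(1) verts .
        show "f (?C (?D x)) \<noteq> 0"
          unfolding CD(1) by (rule f(1))
      qed
    next
      fix p assume p: "p permutes {..<m}"
      then have "?C p \<in> pverts ?G"
        unfolding verts C_perm .
      from f(2)[OF this] show "(\<Sum>k<m. f (?C (cycle_swap m k \<circ> p))) = l * f (?C p)"
        unfolding sum_nbrs[OF p] .
    qed
    then show "\<exists>f. cycle_eigenfunction m l f"
      by - (rule exI)
  next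
    assume "\<exists>f. cycle_eigenfunction m l f"
    then obtain f p where f: "p permutes {..<m}" "f p \<noteq> 0"
      "\<And>p. p permutes {..<m} \<Longrightarrow> (\<Sum>k<m. f (cycle_swap m k \<circ> p)) = l * f p"
      unfolding cycle_eigenfunction_def by blast
    show "\<exists>f. (\<exists>v\<in>pverts ?G. f v \<noteq> 0) \<and>
      (\<forall>v\<in>pverts ?G. (\<Sum>u | u \<in> pverts ?G \<and> (v, u) \<in> parcs ?G. f u) = l * f v)"
    proof (intro exI[of _ "\<lambda>x. f (?D x)"] conjI ballI)
      show "\<exists>v\<in>pverts ?G. f (?D v) \<noteq> 0"
      proof (rule bexI)
        show "f (?D (?C p)) \<noteq> 0"
          unfolding CD(2) by (rule f(2))
        show "?C p \<in> pverts ?G"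
          unfolding verts C_perm by (rule f(1))
      qed
    next
      fix v assume "v \<in> pverts ?G"
      then have "?D v permutes {..<m}"
        unfolding C_perm[symmetric] CD(1) verts .
      from f(3)[OF this] sum_nbrs[OF this, of "\<lambda>x. f (?D x)"]
      show "(\<Sum>u | u \<in> pverts ?G \<and> (v, u) \<in> parcs ?G. f (?D u)) = l * f (?D v)"
        unfolding CD by (rule trans[rotated])
    qed
  qed
  finally show ?thesis .
qed

section \<open>The cosine eigenvalue\<close>

text \<open>Only the swaps with index \<open>i\<close> and its cyclic predecessor move
  \<open>i\<close>, each to one of its two neighbours. The predecessor is written with
  \<open>m - 1\<close> added to avoid truncated subtraction.\<close>

lemma sum_cycle_swap:
  fixes h :: "nat \<Rightarrow> real"
  assumes "3 \<le> m" "i < m"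
  shows "(\<Sum>k<m. h (cycle_swap m k i)) =
    (real m - 2) * h i + h (Suc i mod m) + h ((i + (m - 1)) mod m)"
proof -
  define j where "j = (i + (m - 1)) mod m"
  have Sj: "Suc j mod m = i" and jm: "j < m"
    using assms by (simp_all add: j_def mod_Suc_eq)
  have "j \<noteq> i"
    using Suc_mod_neq[of m j] Sj jm assms by auto
  have "(\<Sum>k<m. h (cycle_swap m k i)) =
      h (cycle_swap m i i) + h (cycle_swap m j i) + (\<Sum>k\<in>{..<m} - {i} - {j}. h (cycle_swap m k i))"
    using assms jm \<open>j \<noteq> i\<close> by (simp add: sum.remove[of _ i] sum.remove[of _ j])
  also have "(\<Sum>k\<in>{..<m} - {i} - {j}. h (cycle_swap m k i)) = (\<Sum>k\<in>{..<m} - {i} - {j}. h i)"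
  proof (rule sum.cong)
    fix k assume k: "k \<in> {..<m} - {i} - {j}"
    then have "Suc k mod m \<noteq> i"
      using inj_on_eq_iff[OF inj_on_Suc_mod, of k m j] Sj jm by auto
    then show "h (cycle_swap m k i) = h i"
      using k by (simp add: cycle_swap_def)
  qed simp
  also have "\<dots> = (real m - 2) * h i"
    using assms jm \<open>j \<noteq> i\<close> by (simp add: of_nat_diff)
  also have "cycle_swap m i i = Suc i mod m"
    by (simp add: cycle_swap_def)
  also have "cycle_swap m j i = j"
    by (simp add: cycle_swap_def Sj)
  finally show ?thesis
    by (simp add: j_def)
qed

lemma cos_mod_period:
  assumes "0 < m"
  shows "cos (2 * pi * real (k mod m) / real m) = cos (2 * pi * real k / real m)"
proof -
  have "real k = real (k mod m) + real m * real (k div m)"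
    by (metis mod_mult_div_eq of_nat_add of_nat_mult)
  then have "2 * pi * real k / real m = 2 * pi * real (k mod m) / real m + 2 * pi * real (k div m)"
    using assms by (simp add: field_simps)
  moreover have "cos (x + 2 * pi * real n) = cos x" for x n
    using cos_2npi[of n] sin_2npi[of n] by (simp add: cos_add mult_ac)
  ultimately show ?thesis
    by simp
qed

text \<open>By \<open>cos (x + y) + cos (x - y) = 2 * cos x * cos y\<close>, the cosine is an
  eigenvector of the cycle graph for \<open>2 * cos (2 * pi / m)\<close>; the swaps that fix
  \<open>p 0\<close> contribute the summand \<open>m - 2\<close>.\<close>

lemma cycle_eigenfunction_cos:
  assumes "3 \<le> m"
  shows "cycle_eigenfunction m (of_real (real m - 2 + 2 * cos (2 * pi / real m)))
    (\<lambda>p. of_real (cos (2 * pi * real (p 0) / real m)))"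
  unfolding cycle_eigenfunction_def
proof (intro conjI allI impI)
  show "\<exists>p. p permutes {..<m} \<and> complex_of_real (cos (2 * pi * real (p 0) / real m)) \<noteq> 0"
    by (rule exI[of _ id]) simp
next
  fix p :: "nat \<Rightarrow> nat" assume p: "p permutes {..<m}"
  define h where "h k = cos (2 * pi * real k / real m)" for k
  define i where "i = p 0"
  have i: "i < m"
    using permutes_in_image[OF p, of 0] assms by (simp add: i_def)
  have "h ((i + (m - 1)) mod m) = h (i + (m - 1))" "h (Suc i mod m) = h (Suc i)"
    using cos_mod_period[of m] assms by (simp_all add: h_def)
  \<comment> \<open>Going forward by \<open>m - 1\<close> places is going back by one place plus a
    full turn.\<close>
  moreover have "h (i + (m - 1)) = cos (2 * pi * real i / real m - 2 * pi / real m + 2 * pi)"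
    unfolding h_def using assms by (intro arg_cong[where f = cos]) (simp add: field_simps of_nat_diff)
  moreover have "h (Suc i) = cos (2 * pi * real i / real m + 2 * pi / real m)"
    unfolding h_def by (intro arg_cong[where f = cos]) (simp add: algebra_simps add_divide_distrib)
  ultimately have "h (Suc i mod m) + h ((i + (m - 1)) mod m) = 2 * cos (2 * pi / real m) * h i"
    unfolding cos_periodic by (simp add: cos_add cos_diff h_def)
  then have "(\<Sum>k<m. h (cycle_swap m k i)) = (real m - 2 + 2 * cos (2 * pi / real m)) * h i"
    using sum_cycle_swap[OF assms i, of h] by (simp add: algebra_simps)
  then show "(\<Sum>k<m. complex_of_real (cos (2 * pi * real ((cycle_swap m k \<circ> p) 0) / real m))) =
      of_real (real m - 2 + 2 * cos (2 * pi / real m)) * of_real (cos (2 * pi * real (p 0) / real m))"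
    unfolding h_def i_def comp_apply of_real_mult[symmetric] of_real_sum[symmetric] by simp
qed

text \<open>For \<open>m = 5\<close> the angle lies strictly between \<open>pi / 3\<close> and
  \<open>pi / 2\<close>, so the value is strictly between 0 and 1. From \<open>m = 7\<close> on the
  angle is positive and below \<open>pi / 3\<close>, so it is strictly between 1 and 2.\<close>

lemma two_cos_not_Ints:
  assumes "m = 5 \<or> 7 \<le> m"
  shows "2 * cos (2 * pi / real m) \<notin> \<int>"
proof
  assume "2 * cos (2 * pi / real m) \<in> \<int>"
  then obtain z where z: "2 * cos (2 * pi / real m) = of_int z"
    by (elim Ints_cases)
  show False
  proof (cases "m = 5")
    case True
    have "cos (2 * pi / 5) < cos (pi / 3)" "cos (pi / 2) < cos (2 * pi / 5)"
      by (rule cos_monotone_0_pi; use pi_gt_zero in \<open>simp add: field_simps\<close>)+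
    with z True have "0 < real_of_int z" "real_of_int z < 1"
      by (simp_all add: cos_60)
    then show False by simp
  next
    case False
    with assms have m: "7 \<le> real m" by simp
    have "cos (pi / 3) < cos (2 * pi / real m)" "cos (2 * pi / real m) < cos 0"
      by (rule cos_monotone_0_pi; use pi_gt_zero m in \<open>simp add: field_simps\<close>)+
    with z have "1 < real_of_int z" "real_of_int z < 2"
      by (simp_all add: cos_60)
    then show False by simp
  qed
qed


section \<open>An irrational eigenvalue for six points\<close>

lemma cycle_eigenfunction_six:
  "\<exists>f. cycle_eigenfunction 6 (of_real (1 + sqrt 5)) f"
proof -
  \<comment> \<open>On functions of the distance 1, 2 or 3, the operator has the matrix with rows
    (4, 2, 0), (2, 2, 2), (0, 4, 2). Its eigenvector for \<open>1 + sqrt 5\<close> is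
    \<open>(2, sqrt 5 - 3, 2 - 2 * sqrt 5)\<close>. The value at \<open>d = 0\<close> is a default:
    \<open>p 0\<close> and \<open>p 1\<close> differ.\<close>
  define H :: "nat \<Rightarrow> nat \<Rightarrow> real" where
    "H i j = (let d = (i + 6 - j) mod 6 in
      if d = 1 \<or> d = 5 then 2 else if d = 3 then 2 - 2 * sqrt 5 else sqrt 5 - 3)" for i j
  have H: "(\<Sum>k<6. H (cycle_swap 6 k i) (cycle_swap 6 k j)) = (1 + sqrt 5) * H i j"
    if "i < 6" "j < 6" "i \<noteq> j" for i j
  proof -
    have expand: "(\<Sum>k<6. h k) = h 0 + h 1 + h 2 + h 3 + h 4 + h 5" for h :: "nat \<Rightarrow> real"
      by (simp add: eval_nat_numeral)
    have "i \<in> {0, 1, 2, 3, 4, 5}" "j \<in> {0, 1, 2, 3, 4, 5}"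
      using that by auto
    then show ?thesis
      using \<open>i \<noteq> j\<close> unfolding expand
      by (elim insertE emptyE; simp only:; simp add: H_def cycle_swap_def transpose_def)
        (simp_all add: algebra_simps)
  qed
  have "cycle_eigenfunction 6 (of_real (1 + sqrt 5)) (\<lambda>p. of_real (H (p 0) (p 1)))"
    unfolding cycle_eigenfunction_def
  proof (intro conjI allI impI)
    show "\<exists>p. p permutes {..<6} \<and> complex_of_real (H (p 0) (p 1)) \<noteq> 0"
      by (rule exI[of _ id]) (simp add: H_def)
  next
    fix p :: "nat \<Rightarrow> nat" assume p: "p permutes {..<6}"
    have "p 0 < 6" "p 1 < 6"
      using permutes_in_image[OF p, of 0] permutes_in_image[OF p, of 1] by simp_all
    moreover have "p 0 \<noteq> p 1"
      using permutes_inj[OF p] by (metis injD zero_neq_one)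
    ultimately show "(\<Sum>k<6. complex_of_real (H ((cycle_swap 6 k \<circ> p) 0) ((cycle_swap 6 k \<circ> p) 1))) =
        of_real (1 + sqrt 5) * of_real (H (p 0) (p 1))"
      unfolding comp_apply of_real_mult[symmetric] of_real_sum[symmetric] using H by metis
  qed
  then show ?thesis
    by - (rule exI)
qed

lemma one_plus_sqrt_5_not_Ints: "1 + sqrt 5 \<notin> \<int>"
proof
  assume "1 + sqrt 5 \<in> \<int>"
  then obtain z where z: "1 + sqrt 5 = of_int z"
    by (elim Ints_cases)
  have "2 < sqrt 5" "sqrt 5 < 3"
    by (auto intro: real_less_rsqrt real_less_lsqrt)
  with z have "3 < real_of_int z" "real_of_int z < 4"
    by linarith+
  then show False by simp
qed

section \<open>Integrality for three and four points\<close>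

text \<open>Right translation by \<open>p\<close> commutes with composing swaps on the left, so a
  point where the function is nonzero can be moved to \<open>id\<close>.\<close>

lemma cycle_eigenfunction_id:
  assumes "cycle_eigenfunction m l f"
  obtains g where "g id \<noteq> 0"
    "\<And>q. q permutes {..<m} \<Longrightarrow> (\<Sum>k<m. g (cycle_swap m k \<circ> q)) = l * g q"
proof -
  obtain p where p: "p permutes {..<m}" "f p \<noteq> 0"
    using assms by (auto simp: cycle_eigenfunction_def)
  show ?thesis
  proof (rule that[of "\<lambda>q. f (q \<circ> p)"])
    fix q assume "q permutes {..<m}"
    then have "q \<circ> p permutes {..<m}"
      using p(1) by (rule permutes_compose[rotated])
    then show "(\<Sum>k<m. f (cycle_swap m k \<circ> q \<circ> p)) = l * f (q \<circ> p)"
      using assms by (simp add: cycle_eigenfunction_def comp_assoc)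
  qed (use p(2) in simp)
qed

text \<open>Every transposition occurs, so each even permutation is adjacent to all three odd ones:
  the graph is the complete bipartite graph on 3 + 3 vertices.\<close>

lemma cycle_eigenvalue_three:
  assumes "cycle_eigenfunction 3 l f"
  shows "l \<in> \<int>"
proof -
  obtain g where g0: "g id \<noteq> 0"
    and g: "\<And>q. q permutes {..<3} \<Longrightarrow> (\<Sum>n<3. g (cycle_swap 3 n \<circ> q)) = l * g q"
    using cycle_eigenfunction_id[OF assms] by blast
  \<comment> \<open>\<open>P\<close> is one-line notation. A swap acts on it entry by entry because
    it fixes all numbers outside \<open>{..<3}\<close>.\<close>
  define P :: "nat \<Rightarrow> nat \<Rightarrow> nat \<Rightarrow> nat \<Rightarrow> nat" where "P i j k = id(0 := i, 1 := j, 2 := k)" for i j k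
  define F where "F i j k = g (P i j k)" for i j k
  have P: "P i j k permutes {..<3}" if "distinct [i, j, k]" "{i, j, k} \<subseteq> {..<3}" for i j k
    by (rule inj_imp_permutes) (use that in \<open>auto simp: P_def inj_on_def numeral_eq_Suc less_Suc_eq\<close>)
  have swap: "cycle_swap 3 n \<circ> P i j k = P (cycle_swap 3 n i) (cycle_swap 3 n j) (cycle_swap 3 n k)"
    if "n < 3" for n i j k
    using permutes_not_in[OF cycle_swap_permutes[OF that]] by (auto simp: fun_eq_iff P_def)
  have F: "l * F i j k = F (cycle_swap 3 0 i) (cycle_swap 3 0 j) (cycle_swap 3 0 k)
      + F (cycle_swap 3 1 i) (cycle_swap 3 1 j) (cycle_swap 3 1 k)
      + F (cycle_swap 3 2 i) (cycle_swap 3 2 j) (cycle_swap 3 2 k)"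
    if "distinct [i, j, k]" "{i, j, k} \<subseteq> {..<3}" for i j k
    using g[OF P[OF that]] swap by (simp add: F_def eval_nat_numeral)
  have swaps: "cycle_swap 3 0 0 = 1" "cycle_swap 3 0 1 = 0" "cycle_swap 3 0 2 = 2"
    "cycle_swap 3 1 0 = 0" "cycle_swap 3 1 1 = 2" "cycle_swap 3 1 2 = 1"
    "cycle_swap 3 2 0 = 2" "cycle_swap 3 2 1 = 1" "cycle_swap 3 2 2 = 0"
    by (simp_all add: cycle_swap_def transpose_def)
  have rows: "l * F 0 1 2 = F 1 0 2 + F 0 2 1 + F 2 1 0"
    "l * F 1 2 0 = F 1 0 2 + F 0 2 1 + F 2 1 0"
    "l * F 2 0 1 = F 1 0 2 + F 0 2 1 + F 2 1 0"
    "l * F 1 0 2 = F 0 1 2 + F 1 2 0 + F 2 0 1"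
    "l * F 0 2 1 = F 0 1 2 + F 1 2 0 + F 2 0 1"
    "l * F 2 1 0 = F 0 1 2 + F 1 2 0 + F 2 0 1"
    by (rule F[THEN trans], simp, simp, simp only: swaps add_ac)+
  have "P 0 1 2 = id"
    by (auto simp: P_def fun_eq_iff)
  then have "F 0 1 2 \<noteq> 0"
    using g0 by (simp add: F_def)
  \<comment> \<open>\<open>N\<close> sums over the even and \<open>N'\<close> over the odd
    permutations. If \<open>N' = 0\<close>, the equation at \<open>id\<close> gives
    \<open>l = 0\<close>; otherwise \<open>l * l = 9\<close>.\<close>
  define N where "N = F 0 1 2 + F 1 2 0 + F 2 0 1"
  define N' where "N' = F 1 0 2 + F 0 2 1 + F 2 1 0"
  have N: "l * N = 3 * N'" "l * N' = 3 * N"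
    by (simp_all add: N_def N'_def rows distrib_left del: One_nat_def)
  have "l * l * N' = 3 * (l * N)"
    unfolding mult.assoc N(2) by (rule mult.left_commute)
  then have "l * l * N' = 9 * N'"
    unfolding N(1) by simp
  moreover have "l * F 0 1 2 = N'"
    by (simp add: rows N'_def del: One_nat_def)
  ultimately have "l * l = 9 \<or> l = 0"
    using \<open>F 0 1 2 \<noteq> 0\<close> by auto
  then have "(l - 3) * (l + 3) = 0 \<or> l = 0"
    by (simp add: algebra_simps)
  then have "l \<in> {3, - 3, 0}"
    by (auto simp: eq_neg_iff_add_eq_0)
  then show ?thesis
    by auto
qed

text \<open>If the sum over the even permutations is nonzero, then \<open>l * l = 16\<close>. If it
  vanishes, the square of the operator closes up on the Klein four-group and leaves only 4 and 0 for
  \<open>l * l\<close>.\<close>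

lemma cycle_eigenvalue_four:
  assumes "cycle_eigenfunction 4 l f"
  shows "l \<in> \<int>"
proof -
  obtain g where g0: "g id \<noteq> 0"
    and g: "\<And>q. q permutes {..<4} \<Longrightarrow> (\<Sum>n<4. g (cycle_swap 4 n \<circ> q)) = l * g q"
    using cycle_eigenfunction_id[OF assms] by blast
  define P :: "nat \<Rightarrow> nat \<Rightarrow> nat \<Rightarrow> nat \<Rightarrow> nat \<Rightarrow> nat"
    where "P i j k m = id(0 := i, 1 := j, 2 := k, 3 := m)" for i j k m
  define F where "F i j k m = g (P i j k m)" for i j k m
  have P: "P i j k m permutes {..<4}" if "distinct [i, j, k, m]" "{i, j, k, m} \<subseteq> {..<4}" for i j k m
    by (rule inj_imp_permutes) (use that in \<open>auto simp: P_def inj_on_def numeral_eq_Suc less_Suc_eq\<close>)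
  have swap: "cycle_swap 4 n \<circ> P i j k m =
      P (cycle_swap 4 n i) (cycle_swap 4 n j) (cycle_swap 4 n k) (cycle_swap 4 n m)"
    if "n < 4" for n i j k m
    using permutes_not_in[OF cycle_swap_permutes[OF that]] by (auto simp: fun_eq_iff P_def)
  have F: "l * F i j k m =
      F (cycle_swap 4 0 i) (cycle_swap 4 0 j) (cycle_swap 4 0 k) (cycle_swap 4 0 m)
      + F (cycle_swap 4 1 i) (cycle_swap 4 1 j) (cycle_swap 4 1 k) (cycle_swap 4 1 m)
      + F (cycle_swap 4 2 i) (cycle_swap 4 2 j) (cycle_swap 4 2 k) (cycle_swap 4 2 m)
      + F (cycle_swap 4 3 i) (cycle_swap 4 3 j) (cycle_swap 4 3 k) (cycle_swap 4 3 m)"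
    if "distinct [i, j, k, m]" "{i, j, k, m} \<subseteq> {..<4}" for i j k m
    using g[OF P[OF that]] swap by (simp add: F_def eval_nat_numeral)
  have swaps: "cycle_swap 4 0 0 = 1" "cycle_swap 4 0 1 = 0" "cycle_swap 4 0 2 = 2" "cycle_swap 4 0 3 = 3"
    "cycle_swap 4 1 0 = 0" "cycle_swap 4 1 1 = 2" "cycle_swap 4 1 2 = 1" "cycle_swap 4 1 3 = 3"
    "cycle_swap 4 2 0 = 0" "cycle_swap 4 2 1 = 1" "cycle_swap 4 2 2 = 3" "cycle_swap 4 2 3 = 2"
    "cycle_swap 4 3 0 = 3" "cycle_swap 4 3 1 = 1" "cycle_swap 4 3 2 = 2" "cycle_swap 4 3 3 = 0"
    by (simp_all add: cycle_swap_def transpose_def)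
  \<comment> \<open>The first twelve equations are at even permutations, whose neighbours are odd;
    the last twelve are the reverse.\<close>
  have rows: "l * F 0 1 2 3 = F 1 0 2 3 + F 0 2 1 3 + F 0 1 3 2 + F 3 1 2 0"
    "l * F 0 2 3 1 = F 1 2 3 0 + F 0 1 3 2 + F 0 3 2 1 + F 3 2 0 1"
    "l * F 0 3 1 2 = F 1 3 0 2 + F 0 3 2 1 + F 0 2 1 3 + F 3 0 1 2"
    "l * F 1 0 3 2 = F 0 1 3 2 + F 2 0 3 1 + F 1 0 2 3 + F 1 3 0 2"
    "l * F 1 2 0 3 = F 0 2 1 3 + F 2 1 0 3 + F 1 3 0 2 + F 1 2 3 0"
    "l * F 1 3 2 0 = F 0 3 2 1 + F 2 3 1 0 + F 1 2 3 0 + F 1 0 2 3"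
    "l * F 2 0 1 3 = F 2 1 0 3 + F 1 0 2 3 + F 3 0 1 2 + F 2 3 1 0"
    "l * F 2 1 3 0 = F 2 0 3 1 + F 1 2 3 0 + F 3 1 2 0 + F 2 1 0 3"
    "l * F 2 3 0 1 = F 2 3 1 0 + F 1 3 0 2 + F 3 2 0 1 + F 2 0 3 1"
    "l * F 3 0 2 1 = F 3 1 2 0 + F 3 0 1 2 + F 2 0 3 1 + F 0 3 2 1"
    "l * F 3 1 0 2 = F 3 0 1 2 + F 3 2 0 1 + F 2 1 0 3 + F 0 1 3 2"
    "l * F 3 2 1 0 = F 3 2 0 1 + F 3 1 2 0 + F 2 3 1 0 + F 0 2 1 3"
    "l * F 0 1 3 2 = F 1 0 3 2 + F 0 2 3 1 + F 0 1 2 3 + F 3 1 0 2"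
    "l * F 0 2 1 3 = F 1 2 0 3 + F 0 1 2 3 + F 0 3 1 2 + F 3 2 1 0"
    "l * F 0 3 2 1 = F 1 3 2 0 + F 0 3 1 2 + F 0 2 3 1 + F 3 0 2 1"
    "l * F 1 0 2 3 = F 0 1 2 3 + F 2 0 1 3 + F 1 0 3 2 + F 1 3 2 0"
    "l * F 1 2 3 0 = F 0 2 3 1 + F 2 1 3 0 + F 1 3 2 0 + F 1 2 0 3"
    "l * F 1 3 0 2 = F 0 3 1 2 + F 2 3 0 1 + F 1 2 0 3 + F 1 0 3 2"
    "l * F 2 0 3 1 = F 2 1 3 0 + F 1 0 3 2 + F 3 0 2 1 + F 2 3 0 1"
    "l * F 2 1 0 3 = F 2 0 1 3 + F 1 2 0 3 + F 3 1 0 2 + F 2 1 3 0"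
    "l * F 2 3 1 0 = F 2 3 0 1 + F 1 3 2 0 + F 3 2 1 0 + F 2 0 1 3"
    "l * F 3 0 1 2 = F 3 1 0 2 + F 3 0 2 1 + F 2 0 1 3 + F 0 3 1 2"
    "l * F 3 1 2 0 = F 3 0 2 1 + F 3 2 1 0 + F 2 1 3 0 + F 0 1 2 3"
    "l * F 3 2 0 1 = F 3 2 1 0 + F 3 1 0 2 + F 2 3 0 1 + F 0 2 3 1"
    by (rule F[THEN trans], simp, simp, simp only: swaps)+
  \<comment> \<open>\<open>N\<close> and \<open>N'\<close> are the sums over the even and the odd permutations.\<close>
  define N where "N = F 0 1 2 3 + F 0 2 3 1 + F 0 3 1 2 + F 1 0 3 2 + F 1 2 0 3 + F 1 3 2 0
    + F 2 0 1 3 + F 2 1 3 0 + F 2 3 0 1 + F 3 0 2 1 + F 3 1 0 2 + F 3 2 1 0"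
  define N' where "N' = F 0 1 3 2 + F 0 2 1 3 + F 0 3 2 1 + F 1 0 2 3 + F 1 2 3 0 + F 1 3 0 2
    + F 2 0 3 1 + F 2 1 0 3 + F 2 3 1 0 + F 3 0 1 2 + F 3 1 2 0 + F 3 2 0 1"
  have N: "l * N = 4 * N'" "l * N' = 4 * N"
    by (simp_all add: N_def N'_def rows distrib_left del: One_nat_def)
  have "l * l * N = 4 * (l * N')"
    unfolding mult.assoc N(1) by (rule mult.left_commute)
  then have "l * l * N = 16 * N"
    unfolding N(2) by simp
  then consider "l * l = 16" | "N = 0"
    by auto
  then have "l * l = 16 \<or> l * l = 4 \<or> l * l = 0"
  proof cases
    case 2
    define p q r s where "p = F 0 1 2 3" and "q = F 1 0 3 2" and "r = F 3 2 1 0" and "s = F 2 3 0 1"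
    note pqrs = p_def q_def r_def s_def
    have "P 0 1 2 3 = id"
      by (auto simp: P_def fun_eq_iff)
    then have "p \<noteq> 0"
      using g0 by (simp add: p_def F_def)
    \<comment> \<open>In the group algebra of the symmetric group, the square of the sum of the four
      transpositions is \<open>3 + u + v - u v\<close> plus the sum of all even permutations, where \<open>u\<close> and \<open>v\<close>
      are the two products of disjoint transpositions of the cycle.\<close>
    have "l * (l * p) = 3 * p + q + r - s + N" "l * (l * q) = 3 * q + p + s - r + N"
      "l * (l * r) = 3 * r + s + p - q + N" "l * (l * s) = 3 * s + r + q - p + N"
      by (simp_all add: N_def pqrs rows distrib_left del: One_nat_def)
    then have eqs: "l * l * p = 3 * p + q + r - s" "l * l * q = 3 * q + p + s - r"
      "l * l * r = 3 * r + s + p - q" "l * l * s = 3 * s + r + q - p"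
      by (simp_all add: 2 mult.assoc)
    \<comment> \<open>The matrix of \<open>eqs\<close> is 0 along (1, -1, -1, 1) and 4 on a
      complement. The combinations \<open>p + q\<close>, \<open>p + r\<close>, \<open>r + s\<close>
      vanish exactly along that direction.\<close>
    then have sums: "(l * l - 4) * (p + q) = 0" "(l * l - 4) * (p + r) = 0" "(l * l - 4) * (r + s) = 0"
      unfolding left_diff_distrib distrib_left by (simp_all only:) simp_all
    show ?thesis
    proof (cases "l * l = 4")
      case False
      with sums have "p + q = 0" "p + r = 0" "r + s = 0"
        by simp_all
      then have "q = - p" "r = - p" "s = p"
        by (simp_all add: eq_neg_iff_add_eq_0 add.commute) (metis add.commute add_left_cancel)
      with eqs(1) have "l * l * p = 0"
        by simp
      with \<open>p \<noteq> 0\<close> show ?thesis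
        by simp
    qed simp
  qed simp
  then have "(l - 4) * (l + 4) = 0 \<or> (l - 2) * (l + 2) = 0 \<or> l = 0"
    by (auto simp: algebra_simps)
  then have "l \<in> {4, - 4, 2, - 2, 0}"
    by (auto simp: eq_neg_iff_add_eq_0)
  then show ?thesis
    by auto
qed

section \<open>From the spectral criterion to the values of \<open>m\<close>\<close>

theorem proposition4:
  fixes m :: nat and T :: "(nat \<Rightarrow> nat) set"
  assumes "m \<ge> 3"
    and "T \<subseteq> transpositions m"
    and "digraph_iso (with_proj (transposition_graph m T)) (with_proj (cycle_graph m))"
  shows "integral_graph (cayley_graph (sym_group m) T) \<longleftrightarrow> m = 3 \<or> m = 4"
proof -
  let ?G = "cayley_graph (sym_group m) T"
  obtain c where c: "bij c" "c ` {..<m} = {1..m}"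
    "T = (\<lambda>k. c \<circ> cycle_swap m k \<circ> inv' c) ` {..<m}"
    using cycle_labelling[OF assms] .
  have pair: "pair_graph ?G"
    by (rule pair_graph_cayley_transpositions) fact
  interpret G: pair_graph ?G
    by (rule pair)
  \<comment> \<open>\<open>integral_graph\<close> quantifies over enumerations; an actual one is
    needed to draw conclusions from integrality.\<close>
  obtain vs where vs: "set vs = pverts ?G" "distinct vs"
    using finite_distinct_list[OF G.pair_finite_verts] by blast
  have "integral_graph ?G \<longleftrightarrow> (\<forall>l f. cycle_eigenfunction m l f \<longrightarrow> l \<in> \<int>)"
    using pair vs eigenvalue_cayley_graph_iff[OF \<open>m \<ge> 3\<close> c] unfolding integral_graph_def by metis
  also have "\<dots> \<longleftrightarrow> m = 3 \<or> m = 4"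
  proof
    assume int: "\<forall>l f. cycle_eigenfunction m l f \<longrightarrow> l \<in> \<int>"
    then have real_int: "x \<in> \<int>" if "cycle_eigenfunction m (of_real x) f" for x f
      using that by (metis of_real_in_Ints_iff)
    \<comment> \<open>Six is treated separately: there the cosine eigenvalue is the integer
      5.\<close>
    have "m \<noteq> 6"
      using cycle_eigenfunction_six one_plus_sqrt_5_not_Ints real_int by blast
    moreover have "2 * cos (2 * pi / real m) \<in> \<int>"
      using Ints_diff[OF real_int[OF cycle_eigenfunction_cos[OF \<open>m \<ge> 3\<close>]], of "real m - 2"] by simp
    then have "\<not> (m = 5 \<or> 7 \<le> m)"
      using two_cos_not_Ints by blast
    ultimately show "m = 3 \<or> m = 4"
      using \<open>m \<ge> 3\<close> by linarith
  next
    assume "m = 3 \<or> m = 4"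
    then show "\<forall>l f. cycle_eigenfunction m l f \<longrightarrow> l \<in> \<int>"
      using cycle_eigenvalue_three cycle_eigenvalue_four by blast
  qed
  finally show ?thesis .
qed

end
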